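(* Let $\mathcal{X}$ be a set and let $\mathcal{F}_d=\{\mathcal{C}_{f,d} : f:\mathcal{X}\to\{0,1\}\}$ be the family of $d$-Hamming balls. Then, for transductive online learning of $\mathcal{F}_d$ (realizable setting) over $T$ rounds: 1. There exists a deterministic algorithm that makes $O(1)$ calls to the ERM oracle and incurs at most $O(d)$ mistakes. 2. There exists a deterministic algorithm that makes $O(T)$ calls to the weak consistency oracle and incurs at most $O(d)$ mistakes.
   Context: $d$-Hamming ball around $f:\mathcal{X}\to\{0,1\}$: $\mathcal{C}_{f,d}=\{g:\mathcal{X}\to\{0,1\} : |\{x\in\mathcal{X}: g(x)\neq f(x)\}|\le d\}$. Transductive online learning with oracle access (realizable setting). The family is known to the learner. The adversary fixes an unknown class $\mathcal{C}$ in the family, a target $c\in\mathcal{C}$ and a sequence $x_{1:T}=(x_1,\dots,x_T)\in\mathcal{X}^T$. The whole sequence is revealed to the learner at the start. The learner can access $\mathcal{C}$ only through an oracle. In round $t=1,\dots,T$ the learner predicts $\hat y_t\in\{0,1\}$, then $y_t=c(x_t)$ is revealed; a mistake occurs if $\hat y_t\neq y_t$. Bounds are worst case over $\mathcal{C}$ in the family, $c\in\mathcal{C}$ and $x_{1:T}\in\mathcal{X}^T$. Weak consistency oracle: given any sequence $S=(x_1,y_1),\dots,(x_n,y_n)$ of pairs in $\mathcal{X}\times\{0,1\}$, it returns "realizable" if some $c\in\mathcal{C}$ is consistent with $S$, and "not realizable" otherwise. ERM oracle: given any subset (possibly empty) $S\subset\mathcal{X}\times\{0,1\}$, it returns some $c\in\mathcal{C}$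 consistent with $S$ if one exists, and "not realizable" otherwise. *)

theory Defs
  imports Main
begin

text \<open>
  The domain is the type \<^typ>\<open>'a\<close> and labels are booleans (\<^term>\<open>True\<close> for 1).  A concept is a
  function \<^typ>\<open>'a \<Rightarrow> bool\<close>, a concept class is a set of concepts, a family is a set of classes.
\<close>

type_synonym 'a concept = "'a \<Rightarrow> bool"

text \<open>Finiteness is explicit because \<^const>\<open>card\<close> is 0 on infinite sets.\<close>

definition hamming_ball :: "'a concept \<Rightarrow> nat \<Rightarrow> 'a concept set" where
  "hamming_ball f d = {g. finite {x. g x \<noteq> f x} \<and> card {x. g x \<noteq> f x} \<le> d}"

definition hamming_family :: "nat \<Rightarrow> 'a concept set set" where
  "hamming_family d = {hamming_ball f d | f. True}"

definition consistent :: "'a concept \<Rightarrow> ('a \<times> bool) set \<Rightarrow> bool" where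
  "consistent c S \<longleftrightarrow> (\<forall>(x, y) \<in> S. c x = y)"

text \<open>
  An oracle is a relation between a class, a query and the answers permitted for that query.  An
  ERM oracle may thus return any consistent concept, and repeated queries need not get the same
  answer.  The answer \<^term>\<open>None\<close> stands for ``not realizable''.
\<close>

type_synonym ('a, 'q, 'r) oracle_spec = "'a concept set \<Rightarrow> 'q \<Rightarrow> 'r \<Rightarrow> bool"

definition weak_consistency_oracle :: "('a, ('a \<times> bool) list, bool) oracle_spec" where
  "weak_consistency_oracle C S r \<longleftrightarrow> (r \<longleftrightarrow> (\<exists>c\<in>C. consistent c (set S)))"

definition erm_oracle :: "('a, ('a \<times> bool) set, 'a concept option) oracle_spec" where
  "erm_oracle C S r \<longleftrightarrow>
     (case r of Some c \<Rightarrow> c \<in> C \<and> consistent c S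
              | None \<Rightarrow> \<not> (\<exists>c\<in>C. consistent c S))"

text \<open>
  A deterministic computation that adaptively asks finitely many oracle queries and then returns
  an output.
\<close>

datatype ('q, 'r, 'b) oracle_comp =
  Return 'b
| Query 'q "'r \<Rightarrow> ('q, 'r, 'b) oracle_comp"

text \<open>
  \<open>exec V p rs b\<close>: when queries are answered according to \<open>V\<close>, the computation \<open>p\<close> can receive
  the successive answers \<open>rs\<close> (one per query) and return \<open>b\<close>.
\<close>

inductive exec :: "('q \<Rightarrow> 'r \<Rightarrow> bool) \<Rightarrow> ('q, 'r, 'b) oracle_comp \<Rightarrow> 'r list \<Rightarrow> 'b \<Rightarrow> bool"
  for V where
  exec_Return: "exec V (Return b) [] b"
| exec_Query: "V q r \<Longrightarrow> exec V (k r) rs b \<Longrightarrow> exec V (Query q k) (r # rs) b"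

text \<open>
  \<open>A xs ys rs\<close> computes the next prediction of the learner \<open>A\<close> from everything it has observed:
  the whole sequence \<open>xs\<close>, the labels \<open>ys\<close> revealed in the earlier rounds, and the answers \<open>rs\<close>
  to all its earlier queries.  Its own earlier queries and predictions are functions of these data.
  Queries made before the first round are attributed to the first prediction.
\<close>

type_synonym ('a, 'q, 'r) learner =
  "'a list \<Rightarrow> bool list \<Rightarrow> 'r list \<Rightarrow> ('q, 'r, bool) oracle_comp"

text \<open>
  \<open>online_run V A xs c t rs m\<close>: after the first \<open>t\<close> rounds on the sequence \<open>xs\<close> with target \<open>c\<close>,
  it is possible that \<open>rs\<close> are all the oracle answers received so far, so that \<open>length rs\<close> is the
  number of calls, and that \<open>m\<close> mistakes have been made.
\<close>

inductive online_run ::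
  "('q \<Rightarrow> 'r \<Rightarrow> bool) \<Rightarrow> ('a, 'q, 'r) learner \<Rightarrow> 'a list \<Rightarrow> 'a concept \<Rightarrow>
     nat \<Rightarrow> 'r list \<Rightarrow> nat \<Rightarrow> bool"
  for V A xs c where
  run_start: "online_run V A xs c 0 [] 0"
| run_round: "online_run V A xs c t rs m \<Longrightarrow> t < length xs \<Longrightarrow>
    exec V (A xs (map c (take t xs)) rs) rs' y \<Longrightarrow>
    online_run V A xs c (Suc t) (rs @ rs') (m + of_bool (y \<noteq> c (xs ! t)))"

definition learns_within ::
  "('a, 'q, 'r) oracle_spec \<Rightarrow> 'a concept set set \<Rightarrow> ('a, 'q, 'r) learner \<Rightarrow>
     nat \<Rightarrow> nat \<Rightarrow> nat \<Rightarrow> bool" where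
  "learns_within V F A T q M \<longleftrightarrow>
     (\<forall>C\<in>F. \<forall>c\<in>C. \<forall>xs. length xs = T \<longrightarrow>
        (\<forall>rs m. online_run (V C) A xs c T rs m \<longrightarrow> length rs \<le> q \<and> m \<le> M))"

text \<open>
  Both oracles always have a permitted answer, and then every learner can complete all rounds;
  hence the quantification over runs in \<^const>\<open>learns_within\<close> is never vacuous.
\<close>

lemma weak_consistency_oracle_total: "\<exists>r. weak_consistency_oracle C S r"
  unfolding weak_consistency_oracle_def by blast

lemma erm_oracle_total: "\<exists>r. erm_oracle C S r"
proof (cases "\<exists>c\<in>C. consistent c S")
  case True
  then obtain c where "c \<in> C" "consistent c S" by blast
  then have "erm_oracle C S (Some c)" by (simp add: erm_oracle_def)
  then show ?thesis ..
next
  case False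
  then have "erm_oracle C S None" by (simp add: erm_oracle_def)
  then show ?thesis ..
qed

lemma exec_total:
  assumes "\<And>q. \<exists>r. V q r"
  shows "\<exists>rs b. exec V p rs b"
proof (induction p)
  case (Return b)
  show ?case by (blast intro: exec_Return)
next
  case (Query q k)
  obtain r where r: "V q r" using assms by blast
  have "\<exists>rs b. exec V (k r) rs b" by (rule Query) simp
  then show ?case using r by (blast intro: exec_Query)
qed

lemma online_run_total:
  assumes "\<And>q. \<exists>r. V q r"
  shows "t \<le> length xs \<Longrightarrow> \<exists>rs m. online_run V A xs c t rs m"
proof (induction t)
  case 0
  show ?case by (blast intro: run_start)
next
  case (Suc t)
  then obtain rs m where run: "online_run V A xs c t rs m" by auto
  obtain rs' y where "exec V (A xs (map c (take t xs)) rs) rs' y"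
    using exec_total[of V "A xs (map c (take t xs)) rs", OF assms] by blast
  with run Suc.prems show ?case by (blast intro: run_round Suc_le_lessD)
qed

end

(*
  With the ERM oracle: a single empty query returns some g in the ball, and g differs from the
  target in at most 2d points by the triangle inequality.  Predict with g on new points and with
  the revealed label on repeated points.

  With the weak consistency oracle: keep a set S of points on which the label 0 is jointly
  realizable, that is, the centre f takes the value 1 at most d times on S.  At a point x ask
  whether S with x added can still be labelled 0.  If so, add x to S and predict 0; otherwise
  f x = 1, because x exceeds the budget d, and the prediction 1 agrees with f.  On new points the
  predictions thus differ from f at most d times, and f differs from the target at most d times.
*)

theory Submission
  imports Defs
begin

text \<open>The index \<open>length ys\<close> is that of the current round. A label already
  revealed for this point takes precedence; \<open>b\<close> is the guess on a new point.\<close>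

definition recall :: "'a list \<Rightarrow> bool list \<Rightarrow> bool \<Rightarrow> bool" where
  "recall xs ys b = (case map_of (zip xs ys) (xs ! length ys) of Some y \<Rightarrow> y | None \<Rightarrow> b)"

lemma map_of_zip_map_take:
  "map_of (zip xs (map c (take t xs))) x = (if x \<in> set (take t xs) then Some (c x) else None)"
proof (induction xs arbitrary: t)
  case Nil
  then show ?case by simp
next
  case (Cons a xs)
  then show ?case by (cases t) auto
qed

lemma recall_revealed:
  assumes "t < length xs"
  shows "recall xs (map c (take t xs)) b = (if xs ! t \<in> set (take t xs) then c (xs ! t) else b)"
  using assms by (simp add: recall_def map_of_zip_map_take)

text \<open>Serves to charge mistakes to distinct points: if each mistake puts a fresh point into a
  growing finite set, the cardinality of that set bounds their number.\<close>

lemma mistakes_step: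
  fixes M M' :: "'a set"
  assumes "m \<le> card M" "finite M'" "M \<subseteq> M'" "wrong \<Longrightarrow> x \<in> M' - M"
  shows "m + of_bool wrong \<le> card M'"
proof (cases wrong)
  case True
  then have "M \<subset> M'" using assms(3,4) by blast
  then have "card M < card M'" by (rule psubset_card_mono[OF assms(2)])
  then show ?thesis using assms(1) True by simp
next
  case False
  then show ?thesis using assms(1) card_mono[OF assms(2,3)] by simp
qed

lemma hamming_ball_diff_card:
  assumes "g \<in> hamming_ball f d" "c \<in> hamming_ball f d"
  shows "finite {x. g x \<noteq> c x}" "card {x. g x \<noteq> c x} \<le> 2 * d"
proof -
  let ?U = "{x. g x \<noteq> f x} \<union> {x. c x \<noteq> f x}"
  have fin: "finite ?U" and sub: "{x. g x \<noteq> c x} \<subseteq> ?U"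
    using assms by (auto simp: hamming_ball_def)
  show "finite {x. g x \<noteq> c x}" by (rule finite_subset[OF sub fin])
  have "card {x. g x \<noteq> c x} \<le> card ?U" by (rule card_mono[OF fin sub])
  also have "\<dots> \<le> card {x. g x \<noteq> f x} + card {x. c x \<noteq> f x}" by (rule card_Un_le)
  also have "\<dots> \<le> 2 * d" using assms by (simp add: hamming_ball_def)
  finally show "card {x. g x \<noteq> c x} \<le> 2 * d" .
qed

text \<open>A concept vanishing on \<open>S\<close> must differ from \<open>f\<close> wherever
  \<open>f\<close> is 1 on \<open>S\<close>, and switching \<open>f\<close> off on \<open>S\<close>
  changes nothing else.\<close>

lemma hamming_ball_realizes_False_iff:
  assumes "finite S"
  shows "(\<exists>c\<in>hamming_ball f d. consistent c ((\<lambda>x. (x, False)) ` S)) \<longleftrightarrow> card {x\<in>S. f x} \<le> d"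
proof
  assume "\<exists>c\<in>hamming_ball f d. consistent c ((\<lambda>x. (x, False)) ` S)"
  then obtain c where c: "finite {x. c x \<noteq> f x}" "card {x. c x \<noteq> f x} \<le> d" "\<forall>x\<in>S. \<not> c x"
    by (auto simp: hamming_ball_def consistent_def)
  have "card {x\<in>S. f x} \<le> card {x. c x \<noteq> f x}"
    by (rule card_mono[OF c(1)]) (use c(3) in auto)
  then show "card {x\<in>S. f x} \<le> d" using c(2) by simp
next
  assume le: "card {x\<in>S. f x} \<le> d"
  let ?c = "\<lambda>x. f x \<and> x \<notin> S"
  have "{x. ?c x \<noteq> f x} = {x\<in>S. f x}" by auto
  then have "?c \<in> hamming_ball f d" using le assms by (simp add: hamming_ball_def)
  moreover have "consistent ?c ((\<lambda>x. (x, False)) ` S)" by (auto simp: consistent_def)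
  ultimately show "\<exists>c\<in>hamming_ball f d. consistent c ((\<lambda>x. (x, False)) ` S)" by blast
qed

inductive_cases exec_ReturnE: "exec V (Return b) rs y"
inductive_cases exec_QueryE: "exec V (Query q k) rs y"

text \<open>The history \<open>rs\<close> is the only memory: it is empty exactly before the single
  query, and afterwards its head supplies the fixed hypothesis.\<close>

definition erm_learner :: "('a, ('a \<times> bool) set, 'a concept option) learner" where
  "erm_learner xs ys rs =
     (let predict = (\<lambda>r. Return (recall xs ys (the r (xs ! length ys))))
      in case rs of [] \<Rightarrow> Query {} predict | r # _ \<Rightarrow> predict r)"

lemma erm_learner_exec:
  assumes exec: "exec (erm_oracle C) (erm_learner xs ys rs) rs' y"
    and rs: "rs = [] \<or> (\<exists>g\<in>C. rs = [Some g])" and "C \<noteq> {}"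
  obtains g where "g \<in> C" "rs @ rs' = [Some g]" "y = recall xs ys (g (xs ! length ys))"
    "rs = [] \<or> rs = [Some g]"
  using rs
proof
  assume "rs = []"
  with exec obtain r where r: "erm_oracle C {} r" "rs' = [r]"
      "y = recall xs ys (the r (xs ! length ys))"
    by (auto simp: erm_learner_def elim!: exec_QueryE exec_ReturnE)
  \<comment> \<open>Every concept is consistent with the empty sample, so a nonempty class excludes
    the answer \<open>None\<close>.\<close>
  then obtain g where "r = Some g" "g \<in> C"
    using \<open>C \<noteq> {}\<close> by (auto simp: erm_oracle_def consistent_def split: option.splits)
  with r \<open>rs = []\<close> show thesis by (intro that[of g]) auto
next
  assume "\<exists>g\<in>C. rs = [Some g]"
  then obtain g where g: "g \<in> C" "rs = [Some g]" by blast
  with exec have "rs' = []" "y = recall xs ys (g (xs ! length ys))"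
    by (auto simp: erm_learner_def elim: exec_ReturnE)
  with g show thesis by (intro that[of g]) auto
qed

lemma erm_learner_run:
  assumes "online_run (erm_oracle C) erm_learner xs c t rs m" "C \<noteq> {}"
  shows "rs = [] \<and> m = 0 \<or>
    (\<exists>g\<in>C. rs = [Some g] \<and> m \<le> card {x \<in> set (take t xs). g x \<noteq> c x})"
  using assms(1)
proof induction
  case run_start
  show ?case by simp
next
  case (run_round t rs m rs' y)
  obtain g where g: "g \<in> C" "rs @ rs' = [Some g]"
      "y = recall xs (map c (take t xs)) (g (xs ! t))" "rs = [] \<or> rs = [Some g]"
    by (rule erm_learner_exec[OF run_round.hyps(3)])
      (use run_round assms(2) in auto)
  have y: "y = (if xs ! t \<in> set (take t xs) then c (xs ! t) else g (xs ! t))"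
    using g(3) recall_revealed[OF run_round.hyps(2)] by simp
  have "m \<le> card {x \<in> set (take t xs). g x \<noteq> c x}"
    using run_round.IH g(4) by auto
  \<comment> \<open>A mistake occurs only at a new point where \<open>g\<close> and \<open>c\<close>
    differ, and that point enters the set in this round.\<close>
  then have "m + of_bool (y \<noteq> c (xs ! t)) \<le> card {x \<in> set (take (Suc t) xs). g x \<noteq> c x}"
    by (rule mistakes_step[where x = "xs ! t"])
      (auto simp: y take_Suc_conv_app_nth[OF run_round.hyps(2)] split: if_splits)
  with g show ?case by auto
qed

text \<open>The call bound is relaxed from 1 to 2 so that one constant covers both calls and
  mistakes.\<close>

lemma erm_learner_learns_hamming_family:
  "learns_within erm_oracle (hamming_family d) erm_learner T 2 (2 * d)"
  unfolding learns_within_def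
proof (intro ballI allI impI)
  fix C c and xs :: "'a list" and rs m
  assume "C \<in> hamming_family d" and c: "c \<in> C"
    and run: "online_run (erm_oracle C) erm_learner xs c T rs m"
  then obtain f where C: "C = hamming_ball f d" by (auto simp: hamming_family_def)
  from erm_learner_run[OF run] c consider "rs = []" "m = 0"
    | g where "g \<in> C" "rs = [Some g]" "m \<le> card {x \<in> set (take T xs). g x \<noteq> c x}"
    by auto
  then show "length rs \<le> 2 \<and> m \<le> 2 * d"
  proof cases
    case 2
    note diff = hamming_ball_diff_card[OF 2(1)[unfolded C] c[unfolded C]]
    have "card {x \<in> set (take T xs). g x \<noteq> c x} \<le> card {x. g x \<noteq> c x}"
      by (rule card_mono[OF diff(1)]) auto
    with 2 diff(2) show ?thesis by simp
  qed simp
qed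

text \<open>With one call per round, the i-th answer belongs to the i-th point, so the set
  \<open>S\<close> can be rebuilt from the answers alone.\<close>

definition accepted :: "'a list \<Rightarrow> bool list \<Rightarrow> 'a list" where
  "accepted xs rs = map fst (filter snd (zip xs rs))"

lemma set_accepted_subset: "set (accepted xs rs) \<subseteq> set (take (length rs) xs)"
  \<comment> \<open>Appending the empty list turns the rule into the fact that \<open>zip\<close>
    only sees the first \<open>length rs\<close> points.\<close>
  using zip_append2[of xs rs "[]"] by (auto simp: accepted_def dest: set_zip_leftD)

lemma accepted_snoc:
  assumes "length rs < length xs"
  shows "accepted xs (rs @ [r]) = accepted xs rs @ (if r then [xs ! length rs] else [])"
proof -
  have "zip xs (rs @ [r]) = zip (take (length rs) xs) rs @ zip (drop (length rs) xs) [r]"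
    by (rule zip_append2)
  also have "zip (take (length rs) xs) rs = zip xs rs"
    using zip_append2[of xs rs "[]"] by simp
  also have "drop (length rs) xs = xs ! length rs # drop (Suc (length rs)) xs"
    by (rule Cons_nth_drop_Suc[OF assms, symmetric])
  finally have "zip xs (rs @ [r]) = zip xs rs @ [(xs ! length rs, r)]" by simp
  then show ?thesis by (simp add: accepted_def)
qed

text \<open>The query is made on repeated points too, which keeps answers aligned with
  rounds.\<close>

definition consistency_learner :: "('a, ('a \<times> bool) list, bool) learner" where
  "consistency_learner xs ys rs =
     Query (map (\<lambda>x. (x, False)) (xs ! length ys # accepted xs rs))
       (\<lambda>r. Return (recall xs ys (\<not> r)))"

text \<open>A wrong 0 at a new point is charged to the second set if \<open>f\<close> is 1 there and
  to the first otherwise; a wrong 1 is charged to the first.\<close>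

lemma consistency_learner_run:
  assumes "online_run (weak_consistency_oracle (hamming_ball f d)) consistency_learner xs c t rs m"
  shows "length rs = t \<and> card {x \<in> set (accepted xs rs). f x} \<le> d \<and>
    m \<le> card ({x \<in> set (take t xs). f x \<noteq> c x} \<union> {x \<in> set (accepted xs rs). f x})"
  using assms
proof induction
  case run_start
  show ?case by (simp add: accepted_def)
next
  case (run_round t rs m rs' y)
  let ?x = "xs ! t" and ?S = "set (accepted xs rs)"
  from run_round.hyps(3) run_round.hyps(2)
  obtain r where rs': "rs' = [r]" and y: "y = recall xs (map c (take t xs)) (\<not> r)"
    and r: "r \<longleftrightarrow> (\<exists>c\<in>hamming_ball f d. consistent c ((\<lambda>x. (x, False)) ` insert ?x ?S))"
    by (auto simp: consistency_learner_def weak_consistency_oracle_def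
        elim!: exec_QueryE exec_ReturnE)
  have len: "length rs = t" and S: "card {x \<in> ?S. f x} \<le> d"
    and m: "m \<le> card ({x \<in> set (take t xs). f x \<noteq> c x} \<union> {x \<in> ?S. f x})"
    using run_round.IH by auto
  have S': "set (accepted xs (rs @ rs')) = (if r then insert ?x ?S else ?S)"
    using accepted_snoc[of rs xs r] len run_round.hyps(2) by (simp add: rs')
  have r_iff: "r \<longleftrightarrow> card {x \<in> insert ?x ?S. f x} \<le> d"
    unfolding r by (rule hamming_ball_realizes_False_iff) simp
  \<comment> \<open>If \<open>f\<close> were 0 at this point, adding it would leave the count within
    the budget and the query would have succeeded.\<close>
  have fx: "f ?x" if "\<not> r"
  proof (rule ccontr)
    assume "\<not> f ?x"
    then have "{x \<in> insert ?x ?S. f x} = {x \<in> ?S. f x}" by auto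
    then show False using that S r_iff by simp
  qed
  \<comment> \<open>Hence a new point lies in neither of the two old sets, as strict growth
    requires.\<close>
  have "?S \<subseteq> set (take t xs)" using set_accepted_subset[of xs rs] len by simp
  then have "m + of_bool (y \<noteq> c ?x) \<le>
      card ({x \<in> set (take (Suc t) xs). f x \<noteq> c x} \<union> {x \<in> set (accepted xs (rs @ rs')). f x})"
    using fx
    by (intro mistakes_step[OF m, where x = ?x])
      (auto simp: y S' recall_revealed run_round.hyps(2)
        take_Suc_conv_app_nth[OF run_round.hyps(2)] split: if_splits)
  then show ?case using len rs' S S' r_iff by auto
qed

lemma consistency_learner_learns_hamming_family:
  "learns_within weak_consistency_oracle (hamming_family d) consistency_learner T (2 * T) (2 * d)"
  unfolding learns_within_def
proof (intro ballI allI impI)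
  fix C c and xs :: "'a list" and rs m
  assume "C \<in> hamming_family d" and c: "c \<in> C"
    and run: "online_run (weak_consistency_oracle C) consistency_learner xs c T rs m"
  then obtain f where C: "C = hamming_ball f d" by (auto simp: hamming_family_def)
  let ?N = "{x \<in> set (take T xs). f x \<noteq> c x}" and ?S = "{x \<in> set (accepted xs rs). f x}"
  note inv = consistency_learner_run[OF run[unfolded C]]
  have "card ?N \<le> card {x. c x \<noteq> f x}"
    by (rule card_mono) (use c in \<open>auto simp: C hamming_ball_def\<close>)
  also have "\<dots> \<le> d" using c by (simp add: C hamming_ball_def)
  finally have "card (?N \<union> ?S) \<le> 2 * d" using card_Un_le[of ?N ?S] inv by linarith
  then show "length rs \<le> 2 * T \<and> m \<le> 2 * d" using inv by linarith
qed

theorem theoremH4: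
  "(\<exists>K::nat. \<forall>d. \<exists>A :: ('a, ('a \<times> bool) set, 'a concept option) learner. \<forall>T.
      learns_within erm_oracle (hamming_family d) A T K (K * d)) \<and>
   (\<exists>K::nat. \<forall>d. \<exists>A :: ('a, ('a \<times> bool) list, bool) learner. \<forall>T.
      learns_within weak_consistency_oracle (hamming_family d) A T (K * T) (K * d))"
  \<comment> \<open>Both parts hold with \<open>K\<close> = 2.\<close>
  using erm_learner_learns_hamming_family consistency_learner_learns_hamming_family by blast

end
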